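(* Suppose that the Markov decision process specified by the DMDP $\mathcal M=(\mathcal S,\mathcal A,\mathcal P,\mathbf r,\gamma)$ is ergodic in the sense that, for some probability distribution vector $\mathbf q$ (with positive entries) and constants $c_1,c_2>0$, one has $c_1\mathbf q\le\nu^\pi\le c_2\mathbf q$ (entrywise) for any policy $\pi$, where $\nu^\pi$ is the stationary distribution under $\pi$. Let $\hat\mu\in\mathcal U_{\theta,\mathbf q}$ where $\theta=1-\gamma+\gamma\frac{c_1}{c_2}$, and let $\hat\pi_{i,a}=\frac{\hat\mu_{i,a}}{\sum_{a'\in\mathcal A}\hat\mu_{i,a'}}$ for $i\in\mathcal S$, $a\in\mathcal A$. Then $$\mathbf q^\top\mathbf v^*-\mathbf q^\top\mathbf v^{\hat\pi}\le\frac{c_2^2}{(1-\gamma)c_1^2}\sum_{a\in\mathcal A,\,i\in\mathcal S}\hat\mu_{i,a}\left(v^*_i-\gamma\sum_{j\in\mathcal S}p_{ij}(a)v^*_j-\sum_{j\in\mathcal S}p_{ij}(a)r_{ij}(a)\right).$$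
   Context: A discounted Markov decision problem (DMDP) is a tuple $\mathcal M=(\mathcal S,\mathcal A,\mathcal P,\mathbf r,\gamma)$ with finite state space $\mathcal S$, finite action space $\mathcal A$, discount factor $\gamma\in(0,1)$, transition probabilities $\mathcal P=\{p_{ij}(a)\}$ ($p_{ij}(a)\ge0$, $\sum_jp_{ij}(a)=1$), and rewards $r_{ij}(a)\in[0,1]$, $i,j\in\mathcal S$, $a\in\mathcal A$. A (stationary randomized) policy $\pi=(\pi_i)_{i\in\mathcal S}$ is a family of probability distributions $\pi_i=(\pi_{i,a})_{a\in\mathcal A}$ on $\mathcal A$. Its transition matrix is $P^\pi_{ij}=\sum_a\pi_{i,a}p_{ij}(a)$, and $\nu^\pi$ is the stationary distribution under $\pi$: the probability vector with $\nu^\pi=(P^\pi)^\top\nu^\pi$. Its value vector is $v^\pi_i=\mathbb E^\pi[\sum_{t\ge1}\gamma^{t-1}r_{i_ti_{t+1}}(a_t)\mid i_1=i]$; equivalently $\mathbf v^\pi=\gamma P^\pi\mathbf v^\pi+\mathbf r^\pi$ with $r^\pi_i=\sum_a\pi_{i,a}\sum_jp_{ij}(a)r_{ij}(a)$. The optimal value vector is $v^*_i=\max_\pi v^\pi_i$; equivalently it is the unique solution of $v^*_i=\max_{a}\{\gamma\sum_jp_{ij}(a)v^*_j+\sum_jp_{ij}(a)r_{ij}(a)\}$. $\mathcal U_{\theta,\mathbf q}=\{\mu\in\mathbb R^{|\mathcal S||\mathcal A|}:\mathbf e^\top\mu=1,\ \mu\ge0,\ \sum_{a}\mu_a\ge\theta\mathbf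 q\}$, where $\mu=(\mu_a)_{a\in\mathcal A}$, $\mu_a=(\mu_{i,a})_{i\in\mathcal S}$, $\mathbf e$ is the all-ones vector and inequalities between vectors are entrywise. *)

theory Defs
  imports "HOL-Probability.Probability"
begin

text \<open>
  A decision process is given by transition probabilities \<open>p\<close>, with \<open>p\<^sub>i\<^sub>j(a) = pmf (p i a) j\<close>,
  rewards \<open>r\<close>, with \<open>r\<^sub>i\<^sub>j(a) = r i j a\<close>, and a discount factor. A stationary randomized policy is
  a function \<open>\<pi> :: 's \<Rightarrow> 'a pmf\<close>. States and actions range over finite types.
\<close>

definition policy_matrix :: "('s::finite \<Rightarrow> 'a::finite \<Rightarrow> 's pmf) \<Rightarrow> ('s \<Rightarrow> 'a pmf) \<Rightarrow> real^'s^'s" where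
  "policy_matrix p \<pi> = (\<chi> i j. \<Sum>a\<in>UNIV. pmf (\<pi> i) a * pmf (p i a) j)"

definition probability_vector :: "real^'s::finite \<Rightarrow> bool" where
  "probability_vector x \<longleftrightarrow> 0 \<le> x \<and> (\<Sum>i\<in>UNIV. x $ i) = 1"

definition stationary_distribution ::
    "('s::finite \<Rightarrow> 'a::finite \<Rightarrow> 's pmf) \<Rightarrow> ('s \<Rightarrow> 'a pmf) \<Rightarrow> real^'s \<Rightarrow> bool" where
  "stationary_distribution p \<pi> \<nu> \<longleftrightarrow>
     probability_vector \<nu> \<and> \<nu> = transpose (policy_matrix p \<pi>) *v \<nu>"

text \<open>
  Ergodicity bounds every stationary distribution of every policy, instead of a chosen \<open>\<nu>\<^sup>\<pi>\<close>.
  Every stochastic matrix on a finite state space has a stationary distribution, and if all of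
  them are entrywise positive (which the lower bound enforces when \<open>q\<close> is positive) there is only
  one; so this is the condition on the stationary distribution, with its uniqueness derived
  rather than assumed.
\<close>

definition ergodic ::
    "('s::finite \<Rightarrow> 'a::finite \<Rightarrow> 's pmf) \<Rightarrow> real^'s \<Rightarrow> real \<Rightarrow> real \<Rightarrow> bool" where
  "ergodic p q c\<^sub>1 c\<^sub>2 \<longleftrightarrow>
     (\<forall>\<pi> \<nu>. stationary_distribution p \<pi> \<nu> \<longrightarrow> c\<^sub>1 *\<^sub>R q \<le> \<nu> \<and> \<nu> \<le> c\<^sub>2 *\<^sub>R q)"

text \<open>
  The law of the trajectory \<open>\<omega> t = (i\<^sub>t, a\<^sub>t)\<close> started in state \<open>i\<close>, by the Ionescu-Tulcea theorem.
  Time is indexed from 0 here, so \<open>\<omega> 0\<close> is the initial state with the first action.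
\<close>

definition trajectory_kernel ::
    "('s \<Rightarrow> 'a \<Rightarrow> 's pmf) \<Rightarrow> ('s \<Rightarrow> 'a pmf) \<Rightarrow> 's \<Rightarrow> nat \<Rightarrow> (nat \<Rightarrow> 's \<times> 'a) \<Rightarrow> ('s \<times> 'a) measure" where
  "trajectory_kernel p \<pi> i t \<omega> = measure_pmf
     (do {
        j \<leftarrow> (case t of 0 \<Rightarrow> return_pmf i | Suc t' \<Rightarrow> p (fst (\<omega> t')) (snd (\<omega> t')));
        a \<leftarrow> \<pi> j;
        return_pmf (j, a)
      })"

definition trajectory_measure ::
    "('s::finite \<Rightarrow> 'a::finite \<Rightarrow> 's pmf) \<Rightarrow> ('s \<Rightarrow> 'a pmf) \<Rightarrow> 's \<Rightarrow> (nat \<Rightarrow> 's \<times> 'a) measure" where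
  "trajectory_measure p \<pi> i =
     projective_family.lim UNIV
       (Ionescu_Tulcea.CI (trajectory_kernel p \<pi> i) (\<lambda>_. count_space UNIV))
       (\<lambda>_. count_space UNIV)"

lemma Ionescu_Tulcea_trajectory_kernel:
  fixes p :: "'s::finite \<Rightarrow> 'a::finite \<Rightarrow> 's pmf"
  shows "Ionescu_Tulcea (trajectory_kernel p \<pi> i) (\<lambda>_. count_space UNIV)"
proof (rule Ionescu_Tulcea.intro)
  fix t :: nat
  show "trajectory_kernel p \<pi> i t \<in>
      PiM {0..<t} (\<lambda>_. count_space UNIV) \<rightarrow>\<^sub>M subprob_algebra (count_space UNIV)"
  proof (cases t)
    case (Suc t')
    define K where "K x = measure_pmf (do {j \<leftarrow> p (fst x) (snd x); a \<leftarrow> \<pi> j; return_pmf (j, a)})" for x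
    have "(\<lambda>\<omega>. \<omega> t') \<in> PiM {0..<t} (\<lambda>_. count_space UNIV) \<rightarrow>\<^sub>M (count_space UNIV :: ('s \<times> 'a) measure)"
      using Suc by (intro measurable_component_singleton) auto
    moreover have "K \<in> count_space UNIV \<rightarrow>\<^sub>M subprob_algebra (count_space UNIV)"
      by (simp add: K_def measure_pmf_in_subprob_algebra)
    ultimately have "(\<lambda>\<omega>. K (\<omega> t')) \<in> PiM {0..<t} (\<lambda>_. count_space UNIV) \<rightarrow>\<^sub>M subprob_algebra (count_space UNIV)"
      by (rule measurable_compose)
    moreover have "trajectory_kernel p \<pi> i t = (\<lambda>\<omega>. K (\<omega> t'))"
      by (simp add: fun_eq_iff trajectory_kernel_def K_def Suc)
    ultimately show ?thesis by simp
  qed (simp add: trajectory_kernel_def[abs_def] measure_pmf_in_subprob_algebra)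
qed (simp add: trajectory_kernel_def measure_pmf.prob_space_axioms)

definition policy_value ::
    "('s::finite \<Rightarrow> 'a::finite \<Rightarrow> 's pmf) \<Rightarrow> ('s \<Rightarrow> 's \<Rightarrow> 'a \<Rightarrow> real) \<Rightarrow> real \<Rightarrow> ('s \<Rightarrow> 'a pmf) \<Rightarrow> real^'s" where
  "policy_value p r \<gamma> \<pi> =
     (\<chi> i. \<integral>\<omega>. (\<Sum>t. \<gamma> ^ t * r (fst (\<omega> t)) (fst (\<omega> (Suc t))) (snd (\<omega> t))) \<partial>trajectory_measure p \<pi> i)"

text \<open>The supremum is a maximum: for bounded rewards, some policy is optimal from every state.\<close>

definition optimal_value ::
    "('s::finite \<Rightarrow> 'a::finite \<Rightarrow> 's pmf) \<Rightarrow> ('s \<Rightarrow> 's \<Rightarrow> 'a \<Rightarrow> real) \<Rightarrow> real \<Rightarrow> real^'s" where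
  "optimal_value p r \<gamma> = (\<chi> i. SUP \<pi>. policy_value p r \<gamma> \<pi> $ i)"

text \<open>Elements \<open>\<mu>\<close> are stored by action: \<open>\<mu> $ a\<close> is the vector \<open>\<mu>\<^sub>a\<close>, and \<open>\<mu>\<^sub>i\<^sub>,\<^sub>a = \<mu> $ a $ i\<close>.\<close>

definition dual_simplex :: "real \<Rightarrow> real^'s \<Rightarrow> (real^'s::finite^'a::finite) set" where
  "dual_simplex \<theta> q =
     {\<mu>. (\<Sum>a\<in>UNIV. \<Sum>i\<in>UNIV. \<mu> $ a $ i) = 1 \<and> 0 \<le> \<mu> \<and> \<theta> *\<^sub>R q \<le> (\<Sum>a\<in>UNIV. \<mu> $ a)}"

end

theory Submission
  imports Defs
begin

text \<open>
  Put \<open>d = v\<^sup>* - v\<^sup>\<pi>\<close> and let \<open>g\<^sub>i\<close> be the mean under \<open>\<pi>\<^sub>i\<close> of the Bellman gaps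
  \<open>v\<^sup>*\<^sub>i - \<gamma> \<Sum>\<^sub>j p\<^sub>i\<^sub>j(a) v\<^sup>*\<^sub>j - \<Sum>\<^sub>j p\<^sub>i\<^sub>j(a) r\<^sub>i\<^sub>j(a)\<close>. Both are nonnegative, and the Bellman
  equation for \<open>v\<^sup>\<pi>\<close> gives \<open>d - \<gamma> P\<^sup>\<pi> d = g\<close> (\<open>mean_bellman_gap\<close>). Pairing this identity with the
  stationary distribution \<open>\<nu>\<close> of \<open>\<pi>\<close> removes the matrix: \<open>(1 - \<gamma>) \<nu> \<bullet> d = \<nu> \<bullet> g\<close>
  (\<open>stationary_discounted_identity\<close>). So if \<open>\<xi>\<^sub>i = \<Sum>\<^sub>a \<mu>\<^sub>i\<^sub>,\<^sub>a\<close> is the state marginal of \<open>\<mu>\<close>, then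
  \<open>c\<^sub>1 q \<bullet> d \<le> \<nu> \<bullet> d = \<nu> \<bullet> g / (1 - \<gamma>) \<le> c\<^sub>2 q \<bullet> g / (1 - \<gamma>) \<le> (c\<^sub>2\<^sup>2 / c\<^sub>1) \<xi> \<bullet> g / (1 - \<gamma>)\<close>,
  where the last step uses \<open>\<xi> \<ge> \<theta> q\<close> and \<open>\<theta> \<ge> c\<^sub>1 / c\<^sub>2\<close>; and \<open>\<xi> \<bullet> g\<close> is the sum on the right-hand
  side of the claim, because \<open>\<mu>\<^sub>i\<^sub>,\<^sub>a = \<xi>\<^sub>i \<pi>\<^sub>i\<^sub>,\<^sub>a\<close>.

  Three facts carry this argument. A stationary distribution exists, as a fixed point of the
  transposed transition matrix on the probability simplex (\<open>stationary_distribution_exists\<close>). The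
  value, which is an expectation over infinite trajectories, satisfies the Bellman equation
  (\<open>policy_value_bellman\<close>): the Markov property of the Ionescu-Tulcea measure reduces it to a
  discounted series of expectations over the laws of the single states. Finally, the supremum
  defining \<open>v\<^sup>*\<close> is attained at one deterministic policy all of whose Bellman gaps are nonnegative,
  by policy improvement (\<open>optimal_deterministic_policy_exists\<close>).
\<close>

section \<open>Comparison principle for discounted stochastic matrices\<close>

definition row_stochastic :: "real^'s^'s::finite \<Rightarrow> bool" where
  "row_stochastic P \<longleftrightarrow> (\<forall>i j. 0 \<le> P $ i $ j) \<and> (\<forall>i. (\<Sum>j\<in>UNIV. P $ i $ j) = 1)"

lemma row_stochastic_policy_matrix: "row_stochastic (policy_matrix p \<pi>)"
proof -
  have "(\<Sum>j\<in>UNIV. \<Sum>a\<in>UNIV. pmf (\<pi> i) a * pmf (p i a) j) = 1" for i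
    by (subst sum.swap) (simp add: sum_distrib_left[symmetric] sum_pmf_eq_1)
  then show ?thesis
    by (auto simp: row_stochastic_def policy_matrix_def intro!: sum_nonneg)
qed

text \<open>
  A maximum principle: at a state where \<open>d\<close> attains its maximum \<open>m\<close>, averaging cannot exceed \<open>m\<close>, so
  \<open>m \<le> \<gamma> m\<close> and hence \<open>m \<le> 0\<close>. All comparisons between value vectors below come from this.
\<close>

lemma discounted_subharmonic_le_0:
  fixes d :: "real^'s::finite"
  assumes P: "row_stochastic P" and \<gamma>: "0 \<le> \<gamma>" "\<gamma> < 1"
    and d: "\<And>i. d $ i \<le> \<gamma> * (P *v d) $ i"
  shows "d $ i \<le> 0"
proof -
  define m where "m = (MAX j. d $ j)"
  have le_m: "d $ j \<le> m" for j
    by (simp add: m_def)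
  have "m \<in> range (\<lambda>j. d $ j)"
    unfolding m_def by (rule Max_in) auto
  then obtain k where k: "m = d $ k"
    by blast
  have "(P *v d) $ k \<le> (\<Sum>j\<in>UNIV. P $ k $ j * m)"
    using P le_m by (auto simp: matrix_vector_mult_def row_stochastic_def intro!: sum_mono mult_left_mono)
  also have "\<dots> = m"
    using P by (simp add: sum_distrib_right[symmetric] row_stochastic_def)
  finally have "m \<le> \<gamma> * m"
    using d[of k] \<gamma> k by (smt (verit) mult_left_mono)
  then have "(1 - \<gamma>) * m \<le> 0"
    by (simp add: algebra_simps)
  then have "m \<le> 0"
    using \<gamma> by (simp add: mult_le_0_iff)
  with le_m[of i] show ?thesis
    by simp
qed

section \<open>Existence of stationary distributions\<close>

lemma compact_probability_simplex: "compact {x :: real^'s::finite. probability_vector x}"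
proof -
  have "{x :: real^'s. probability_vector x} =
      cbox 0 1 \<inter> {x. (\<Sum>i\<in>UNIV. x $ i) = 1}"
  proof (intro equalityI subsetI)
    fix x :: "real^'s" assume "x \<in> {x. probability_vector x}"
    then have x: "0 \<le> x $ i" "(\<Sum>i\<in>UNIV. x $ i) = 1" for i
      by (auto simp: probability_vector_def less_eq_vec_def)
    have "x $ i \<le> 1" for i
      using member_le_sum[of i UNIV "\<lambda>i. x $ i"] x by auto
    with x show "x \<in> cbox 0 1 \<inter> {x. (\<Sum>i\<in>UNIV. x $ i) = 1}"
      by (auto simp: mem_box_cart)
  qed (auto simp: probability_vector_def less_eq_vec_def mem_box_cart)
  moreover have "closed {x :: real^'s. (\<Sum>i\<in>UNIV. x $ i) = 1}"
    by (intro closed_Collect_eq continuous_intros)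
  ultimately show ?thesis
    by (simp add: compact_Int_closed)
qed

lemma convex_probability_simplex: "convex {x :: real^'s::finite. probability_vector x}"
  by (rule convexI)
    (auto simp: probability_vector_def less_eq_vec_def sum.distrib sum_distrib_left[symmetric])

text \<open>
  Brouwer's theorem applies because the transpose of a row-stochastic matrix maps the probability
  simplex into itself.
\<close>

lemma stationary_distribution_exists:
  fixes p :: "'s::finite \<Rightarrow> 'a::finite \<Rightarrow> 's pmf"
  obtains \<nu> where "stationary_distribution p \<pi> \<nu>"
proof -
  let ?S = "{x :: real^'s. probability_vector x}"
  let ?P = "policy_matrix p \<pi>"
  have P: "row_stochastic ?P"
    by (rule row_stochastic_policy_matrix)
  have "axis undefined 1 \<in> ?S"
    by (auto simp: probability_vector_def less_eq_vec_def axis_def)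
  then have ne: "?S \<noteq> {}"
    by blast
  have cont: "continuous_on ?S (\<lambda>x. transpose ?P *v x)"
    by (intro linear_continuous_on matrix_vector_mul_bounded_linear)
  have into: "(\<lambda>x. transpose ?P *v x) \<in> ?S \<rightarrow> ?S"
  proof
    fix x :: "real^'s" assume x: "x \<in> ?S"
    have "(\<Sum>i\<in>UNIV. (transpose ?P *v x) $ i) = (\<Sum>j\<in>UNIV. \<Sum>i\<in>UNIV. ?P $ j $ i * x $ j)"
      unfolding matrix_vector_mult_def transpose_def by (simp, rule sum.swap)
    also have "\<dots> = 1"
      using P x by (simp add: sum_distrib_right[symmetric] row_stochastic_def probability_vector_def)
    finally show "transpose ?P *v x \<in> ?S"
      using P x
      by (auto simp: probability_vector_def less_eq_vec_def row_stochastic_def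
          matrix_vector_mult_def transpose_def intro!: sum_nonneg)
  qed
  from brouwer[OF compact_probability_simplex convex_probability_simplex ne cont into]
  obtain \<nu> where "\<nu> \<in> ?S" "transpose ?P *v \<nu> = \<nu>" .
  then show ?thesis
    by (intro that[of \<nu>]) (simp add: stationary_distribution_def)
qed

section \<open>Trajectory laws\<close>

text \<open>
  A trajectory consists of state-action pairs, while its mean rewards are governed by the chain of
  states. The laws below describe a pair given its state, one transition between states, and the state at a
  given time; the values of policies are expressed through them.
\<close>

definition state_action_law :: "('s \<Rightarrow> 'a pmf) \<Rightarrow> 's \<Rightarrow> ('s \<times> 'a) pmf" where
  "state_action_law \<pi> i = map_pmf (Pair i) (\<pi> i)"

definition step_law :: "('s \<Rightarrow> 'a \<Rightarrow> 's pmf) \<Rightarrow> ('s \<Rightarrow> 'a pmf) \<Rightarrow> 's \<Rightarrow> 's pmf" where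
  "step_law p \<pi> i = do {a \<leftarrow> \<pi> i; p i a}"

primrec state_law :: "('s \<Rightarrow> 'a \<Rightarrow> 's pmf) \<Rightarrow> ('s \<Rightarrow> 'a pmf) \<Rightarrow> 's \<Rightarrow> nat \<Rightarrow> 's pmf" where
  "state_law p \<pi> i 0 = return_pmf i"
| "state_law p \<pi> i (Suc t) = do {j \<leftarrow> state_law p \<pi> i t; step_law p \<pi> j}"

text \<open>
  The recursion for \<open>state_law\<close> adds a transition at the end. The Bellman equation conditions on the
  first transition instead.
\<close>

lemma state_law_Suc_first: "state_law p \<pi> i (Suc t) = do {j \<leftarrow> step_law p \<pi> i; state_law p \<pi> j t}"
proof (induction t)
  case 0
  show ?case
    by (simp add: bind_return_pmf bind_return_pmf')
next
  case (Suc t)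
  have "state_law p \<pi> i (Suc (Suc t)) = state_law p \<pi> i (Suc t) \<bind> step_law p \<pi>"
    by simp
  then show ?case
    unfolding Suc by (simp add: bind_assoc_pmf)
qed

lemma trajectory_kernel_0: "trajectory_kernel p \<pi> i 0 \<omega> = measure_pmf (state_action_law \<pi> i)"
  by (simp add: trajectory_kernel_def state_action_law_def map_pmf_def bind_return_pmf)

lemma trajectory_kernel_Suc:
  "trajectory_kernel p \<pi> i (Suc t) \<omega> = measure_pmf (p (fst (\<omega> t)) (snd (\<omega> t)) \<bind> state_action_law \<pi>)"
  by (simp add: trajectory_kernel_def state_action_law_def[abs_def] map_pmf_def)

context
  fixes p :: "'s::finite \<Rightarrow> 'a::finite \<Rightarrow> 's pmf" and \<pi> :: "'s \<Rightarrow> 'a pmf" and i :: 's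
begin

interpretation IT: Ionescu_Tulcea "trajectory_kernel p \<pi> i" "\<lambda>_. count_space UNIV"
  by (rule Ionescu_Tulcea_trajectory_kernel)

lemma trajectory_measure_eq_lim: "trajectory_measure p \<pi> i = IT.PF.lim"
  by (simp add: trajectory_measure_def)

lemma sets_trajectory_measure [measurable_cong]:
  "sets (trajectory_measure p \<pi> i) = sets (PiM UNIV (\<lambda>_. count_space UNIV))"
  by (simp add: trajectory_measure_eq_lim)

lemma measurable_trajectory_component:
  "(\<lambda>\<omega>. \<omega> t) \<in> trajectory_measure p \<pi> i \<rightarrow>\<^sub>M count_space UNIV"
  by (simp add: measurable_cong_sets[OF sets_trajectory_measure refl])

text \<open>
  The trajectory measure is a projective limit, and the law of its first \<open>n\<close> coordinates is the
  \<open>n\<close>-fold composition of the kernels. The laws of single coordinates and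
  the Markov property are both read off from this.
\<close>

lemma distr_trajectory_restrict:
  "distr (trajectory_measure p \<pi> i) (PiM {0..<n} (\<lambda>_. count_space UNIV)) (\<lambda>\<omega>. restrict \<omega> {0..<n}) =
     IT.C 0 n (\<lambda>_. undefined)"
proof -
  have "IT.up_to {0..<n} = n"
  proof (rule antisym)
    show "IT.up_to {0..<n} \<le> n"
      by (simp add: IT.up_to_iff_Ico)
    show "n \<le> IT.up_to {0..<n}"
      using IT.up_to[of "{0..<n}"] by (cases "n = 0") simp_all
  qed
  then have "IT.CI {0..<n} = distr (IT.C 0 n (\<lambda>_. undefined)) (PiM {0..<n} (\<lambda>_. count_space UNIV))
      (\<lambda>\<omega>. restrict \<omega> {0..<n})"
    by (simp add: IT.CI_def)
  also have "\<dots> = IT.C 0 n (\<lambda>_. undefined)"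
    using IT.distr_C[of n n "\<lambda>_. undefined" 0] by simp
  finally show ?thesis
    using IT.distr_lim[of "{0..<n}"] by (simp add: trajectory_measure_eq_lim)
qed

lemma prob_space_trajectory_measure: "prob_space (trajectory_measure p \<pi> i)"
proof -
  have "prob_space (IT.C 0 0 (\<lambda>_. undefined))"
    by (rule IT.prob_space_C) simp
  then show ?thesis
    unfolding distr_trajectory_restrict[of 0, symmetric]
    by (rule prob_space_distrD[rotated]) measurable
qed

lemma nn_integral_trajectory_prefix:
  assumes f: "f \<in> borel_measurable (PiM {0..<n} (\<lambda>_. count_space UNIV))"
  shows "(\<integral>\<^sup>+\<omega>. f (restrict \<omega> {0..<n}) \<partial>trajectory_measure p \<pi> i) =
    (\<integral>\<^sup>+\<omega>. f \<omega> \<partial>IT.C 0 n (\<lambda>_. undefined))"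
  unfolding distr_trajectory_restrict[symmetric]
  by (subst nn_integral_distr) (use f in auto)

text \<open>
  The next coordinate can be integrated out first, against the kernel, with the earlier ones held
  fixed. Both sides are integrals over the same trajectory measure, so that no intermediate space of
  finite trajectories appears in the applications.
\<close>

lemma nn_integral_trajectory_Suc:
  assumes f: "f \<in> borel_measurable (PiM {0..<Suc n} (\<lambda>_. count_space UNIV))"
  shows "(\<integral>\<^sup>+\<omega>. f (restrict \<omega> {0..<Suc n}) \<partial>trajectory_measure p \<pi> i) =
    (\<integral>\<^sup>+\<omega>. (\<integral>\<^sup>+y. f ((restrict \<omega> {0..<n})(n := y)) \<partial>trajectory_kernel p \<pi> i n (restrict \<omega> {0..<n}))
       \<partial>trajectory_measure p \<pi> i)"
proof -
  have *: "(\<lambda>\<omega>. \<integral>\<^sup>+x. f x \<partial>IT.eP n \<omega>) \<in> borel_measurable (PiM {0..<n} (\<lambda>_. count_space UNIV))"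
    using nn_integral_measurable_subprob_algebra[OF f] IT.measurable_eP[of n] by measurable
  have "(\<integral>\<^sup>+\<omega>. f (restrict \<omega> {0..<Suc n}) \<partial>trajectory_measure p \<pi> i) =
      (\<integral>\<^sup>+\<omega>. f \<omega> \<partial>IT.C 0 (Suc n) (\<lambda>_. undefined))"
    by (rule nn_integral_trajectory_prefix[OF f])
  also have "\<dots> = (\<integral>\<^sup>+\<omega>. (\<integral>\<^sup>+x. f x \<partial>IT.eP n \<omega>) \<partial>IT.C 0 n (\<lambda>_. undefined))"
    using f by (simp add: nn_integral_bind[where B="PiM {0..<Suc n} (\<lambda>_. count_space UNIV)"] IT.measurable_eP IT.sets_C
       cong: measurable_cong_sets)
  also have "\<dots> = (\<integral>\<^sup>+\<omega>. (\<integral>\<^sup>+x. f x \<partial>IT.eP n (restrict \<omega> {0..<n})) \<partial>trajectory_measure p \<pi> i)"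
    by (rule nn_integral_trajectory_prefix[OF *, symmetric])
  also have "\<dots> = (\<integral>\<^sup>+\<omega>. (\<integral>\<^sup>+y. f ((restrict \<omega> {0..<n})(n := y)) \<partial>trajectory_kernel p \<pi> i n (restrict \<omega> {0..<n}))
       \<partial>trajectory_measure p \<pi> i)"
    by (intro nn_integral_cong IT.nn_integral_eP f) (auto simp: space_PiM)
  finally show ?thesis .
qed

lemma nn_integral_trajectory_0:
  "(\<integral>\<^sup>+\<omega>. f (\<omega> 0) \<partial>trajectory_measure p \<pi> i) = (\<integral>\<^sup>+x. f x \<partial>measure_pmf (state_action_law \<pi> i))"
proof -
  interpret prob_space "trajectory_measure p \<pi> i"
    by (rule prob_space_trajectory_measure)
  have "(\<lambda>\<omega>. f (\<omega> 0)) \<in> borel_measurable (PiM {0..<Suc 0} (\<lambda>_. count_space UNIV))"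
    by (rule measurable_compose[OF measurable_component_singleton]) auto
  from nn_integral_trajectory_Suc[OF this] show ?thesis
    by (simp add: trajectory_kernel_0 emeasure_space_1)
qed

text \<open>
  The index set is a parameter because the same map is needed on finite prefixes, where the kernels
  act, and on whole trajectories.
\<close>

lemma measurable_transition:
  fixes f :: "'s \<times> 'a \<Rightarrow> 's \<times> 'a \<Rightarrow> 'b::topological_space"
  assumes "t \<in> I" and "Suc t \<in> I"
  shows "(\<lambda>\<omega>. f (\<omega> t) (\<omega> (Suc t))) \<in> borel_measurable (PiM I (\<lambda>_. count_space UNIV))"
proof -
  let ?M = "PiM I (\<lambda>_. count_space (UNIV :: ('s \<times> 'a) set))"
  have t: "(\<lambda>\<omega>. \<omega> t) \<in> ?M \<rightarrow>\<^sub>M count_space UNIV"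
    and Suc_t: "(\<lambda>\<omega>. \<omega> (Suc t)) \<in> ?M \<rightarrow>\<^sub>M count_space UNIV"
    using assms by (auto intro: measurable_component_singleton)
  have "(\<lambda>\<omega>. f x (\<omega> (Suc t))) \<in> borel_measurable ?M" for x
    by (rule measurable_compose[OF Suc_t]) simp
  then show ?thesis
    by (rule measurable_compose_countable) (rule t)
qed

lemma borel_measurable_trajectory_transition:
  "(\<lambda>\<omega>. f (fst (\<omega> t)) (fst (\<omega> (Suc t))) (snd (\<omega> t))) \<in> borel_measurable (trajectory_measure p \<pi> i)"
  using measurable_transition[of t UNIV "\<lambda>x y. f (fst x) (fst y) (snd x)"]
  by (simp add: measurable_cong_sets[OF sets_trajectory_measure refl])

text \<open>
  The Markov property: the conditional law of the next pair depends only on the present one.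
\<close>

lemma nn_integral_trajectory_step:
  "(\<integral>\<^sup>+\<omega>. f (\<omega> t) (\<omega> (Suc t)) \<partial>trajectory_measure p \<pi> i) =
   (\<integral>\<^sup>+\<omega>. (\<integral>\<^sup>+y. f (\<omega> t) y \<partial>measure_pmf (p (fst (\<omega> t)) (snd (\<omega> t)) \<bind> state_action_law \<pi>)) \<partial>trajectory_measure p \<pi> i)"
proof -
  have "(\<lambda>\<omega>. f (\<omega> t) (\<omega> (Suc t))) \<in> borel_measurable (PiM {0..<Suc (Suc t)} (\<lambda>_. count_space UNIV))"
    by (rule measurable_transition) simp_all
  from nn_integral_trajectory_Suc[OF this] show ?thesis
    unfolding trajectory_kernel_Suc by simp
qed

lemma distr_trajectory_component:
  "distr (trajectory_measure p \<pi> i) (count_space UNIV) (\<lambda>\<omega>. \<omega> t) = measure_pmf (state_law p \<pi> i t \<bind> state_action_law \<pi>)"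
proof (induction t)
  case 0
  show ?case
  proof (rule measure_eqI)
    fix A
    show "emeasure (distr (trajectory_measure p \<pi> i) (count_space UNIV) (\<lambda>\<omega>. \<omega> 0)) A =
        emeasure (measure_pmf (state_law p \<pi> i 0 \<bind> state_action_law \<pi>)) A"
      using nn_integral_trajectory_0[of "indicator A"] measurable_trajectory_component[of 0]
      by (subst nn_integral_indicator[symmetric], simp, subst nn_integral_distr) (simp_all add: bind_return_pmf)
  qed simp
next
  case (Suc t)
  have law_Suc: "state_law p \<pi> i (Suc t) \<bind> state_action_law \<pi> =
      (state_law p \<pi> i t \<bind> state_action_law \<pi>) \<bind> (\<lambda>x. p (fst x) (snd x) \<bind> state_action_law \<pi>)"
    by (simp add: bind_assoc_pmf state_action_law_def map_pmf_def step_law_def bind_return_pmf)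
  show ?case
  proof (rule measure_eqI)
    fix A
    have "emeasure (distr (trajectory_measure p \<pi> i) (count_space UNIV) (\<lambda>\<omega>. \<omega> (Suc t))) A =
        (\<integral>\<^sup>+\<omega>. indicator A (\<omega> (Suc t)) \<partial>trajectory_measure p \<pi> i)"
      using measurable_trajectory_component[of "Suc t"]
      by (subst nn_integral_indicator[symmetric], simp, subst nn_integral_distr) simp_all
    also have "\<dots> = (\<integral>\<^sup>+\<omega>. emeasure (measure_pmf (p (fst (\<omega> t)) (snd (\<omega> t)) \<bind> state_action_law \<pi>)) A \<partial>trajectory_measure p \<pi> i)"
      by (subst nn_integral_trajectory_step) simp
    also have "\<dots> = (\<integral>\<^sup>+x. emeasure (measure_pmf (p (fst x) (snd x) \<bind> state_action_law \<pi>)) A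
        \<partial>distr (trajectory_measure p \<pi> i) (count_space UNIV) (\<lambda>\<omega>. \<omega> t))"
      using measurable_trajectory_component[of t]
      by (subst nn_integral_distr) simp_all
    also have "\<dots> = emeasure (measure_pmf (state_law p \<pi> i (Suc t) \<bind> state_action_law \<pi>)) A"
      by (simp only: Suc law_Suc emeasure_bind_pmf[of "state_law p \<pi> i t \<bind> state_action_law \<pi>"])
    finally show "emeasure (distr (trajectory_measure p \<pi> i) (count_space UNIV) (\<lambda>\<omega>. \<omega> (Suc t))) A = \<dots>" .
  qed simp
qed

end

section \<open>The Bellman equation of a policy\<close>

definition policy_reward ::
    "('s::finite \<Rightarrow> 'a::finite \<Rightarrow> 's pmf) \<Rightarrow> ('s \<Rightarrow> 's \<Rightarrow> 'a \<Rightarrow> real) \<Rightarrow> ('s \<Rightarrow> 'a pmf) \<Rightarrow> real^'s" where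
  "policy_reward p r \<pi> = (\<chi> i. \<Sum>a\<in>UNIV. pmf (\<pi> i) a * (\<Sum>j\<in>UNIV. pmf (p i a) j * r i j a))"

text \<open>
  The reward at time \<open>t\<close> depends on the next state too; the Markov property replaces it by its mean
  over the next state, and averaging over the action then leaves a function of the state alone.
\<close>

lemma expectation_trajectory_reward:
  assumes r: "\<And>i j a. 0 \<le> r i j a"
  shows "(\<integral>\<omega>. r (fst (\<omega> t)) (fst (\<omega> (Suc t))) (snd (\<omega> t)) \<partial>trajectory_measure p \<pi> i) =
    measure_pmf.expectation (state_law p \<pi> i t) (\<lambda>s. policy_reward p r \<pi> $ s)"
proof -
  \<comment> \<open>The mean reward of a state-action pair, averaged over the next state.\<close>
  define R where "R x = (\<Sum>j\<in>UNIV. pmf (p (fst x) (snd x)) j * r (fst x) j (snd x))" for x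
  have R_nonneg: "0 \<le> R x" for x
    unfolding R_def by (intro sum_nonneg mult_nonneg_nonneg pmf_nonneg r)
  have inner: "(\<integral>\<^sup>+y. ennreal (r (fst x) (fst y) (snd x)) \<partial>measure_pmf (p (fst x) (snd x) \<bind> state_action_law \<pi>)) =
      ennreal (R x)" for x
  proof -
    have "map_pmf fst (p (fst x) (snd x) \<bind> state_action_law \<pi>) = p (fst x) (snd x)"
      by (simp add: map_bind_pmf state_action_law_def pmf.map_comp comp_def bind_return_pmf')
    then have "(\<integral>y. r (fst x) (fst y) (snd x) \<partial>measure_pmf (p (fst x) (snd x) \<bind> state_action_law \<pi>)) =
        (\<integral>j. r (fst x) j (snd x) \<partial>measure_pmf (p (fst x) (snd x)))"
      using integral_map_pmf[of fst "p (fst x) (snd x) \<bind> state_action_law \<pi>" "\<lambda>j. r (fst x) j (snd x)"] by simp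
    also have "\<dots> = R x"
      by (simp add: R_def integral_measure_pmf[of UNIV])
    finally show ?thesis
      by (subst nn_integral_eq_integral) (auto simp: r integrable_measure_pmf_finite)
  qed
  have mean_R: "measure_pmf.expectation (state_action_law \<pi> s) R = policy_reward p r \<pi> $ s" for s
    by (simp add: state_action_law_def integral_measure_pmf[of UNIV] R_def policy_reward_def)
  have "(\<integral>\<^sup>+\<omega>. ennreal (r (fst (\<omega> t)) (fst (\<omega> (Suc t))) (snd (\<omega> t))) \<partial>trajectory_measure p \<pi> i) =
      (\<integral>\<^sup>+\<omega>. ennreal (R (\<omega> t)) \<partial>trajectory_measure p \<pi> i)"
    using nn_integral_trajectory_step[where f="\<lambda>x y. ennreal (r (fst x) (fst y) (snd x))"]
    by (simp only: inner)
  also have "\<dots> = (\<integral>\<^sup>+x. ennreal (R x) \<partial>measure_pmf (state_law p \<pi> i t \<bind> state_action_law \<pi>))"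
    unfolding distr_trajectory_component[symmetric]
    using measurable_trajectory_component by (subst nn_integral_distr) simp_all
  also have "\<dots> = ennreal (measure_pmf.expectation (state_law p \<pi> i t \<bind> state_action_law \<pi>) R)"
    by (rule nn_integral_eq_integral) (auto simp: R_nonneg integrable_measure_pmf_finite)
  also have "measure_pmf.expectation (state_law p \<pi> i t \<bind> state_action_law \<pi>) R =
      measure_pmf.expectation (state_law p \<pi> i t) (\<lambda>s. policy_reward p r \<pi> $ s)"
    by (subst pmf_expectation_bind[of UNIV]) (simp_all add: mean_R integral_measure_pmf[of UNIV])
  finally have "(\<integral>\<^sup>+\<omega>. ennreal (r (fst (\<omega> t)) (fst (\<omega> (Suc t))) (snd (\<omega> t))) \<partial>trajectory_measure p \<pi> i) =
      ennreal (measure_pmf.expectation (state_law p \<pi> i t) (\<lambda>s. policy_reward p r \<pi> $ s))" .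
  moreover have "0 \<le> measure_pmf.expectation (state_law p \<pi> i t) (\<lambda>s. policy_reward p r \<pi> $ s)"
    by (rule integral_nonneg_AE) (auto simp: policy_reward_def intro!: sum_nonneg mult_nonneg_nonneg r)
  ultimately show ?thesis
    by (subst integral_eq_nn_integral[OF borel_measurable_trajectory_transition]) (simp_all add: r)
qed

text \<open>
  The amount by which the inequality \<open>w\<^sub>i \<ge> \<gamma> \<Sum>\<^sub>j p\<^sub>i\<^sub>j(a) w\<^sub>j + \<Sum>\<^sub>j p\<^sub>i\<^sub>j(a) r\<^sub>i\<^sub>j(a)\<close> is satisfied, that is,
  the reduced cost of \<open>(i, a)\<close> in the linear program for the optimal value vector. For \<open>w = v\<^sup>*\<close> it is
  the factor of \<open>\<mu>\<^sub>i\<^sub>,\<^sub>a\<close> in the duality gap.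
\<close>

definition bellman_gap ::
    "('s::finite \<Rightarrow> 'a::finite \<Rightarrow> 's pmf) \<Rightarrow> ('s \<Rightarrow> 's \<Rightarrow> 'a \<Rightarrow> real) \<Rightarrow> real \<Rightarrow> real^'s \<Rightarrow> 's \<Rightarrow> 'a \<Rightarrow> real" where
  "bellman_gap p r \<gamma> w i a =
     w $ i - \<gamma> * (\<Sum>j\<in>UNIV. pmf (p i a) j * w $ j) - (\<Sum>j\<in>UNIV. pmf (p i a) j * r i j a)"

context
  fixes p :: "'s::finite \<Rightarrow> 'a::finite \<Rightarrow> 's pmf" and r :: "'s \<Rightarrow> 's \<Rightarrow> 'a \<Rightarrow> real" and \<gamma> :: real
  assumes \<gamma>: "0 < \<gamma>" "\<gamma> < 1" and r: "\<And>i j a. r i j a \<in> {0..1}"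
begin

text \<open>
  Integral and series may be exchanged because the discounted reward at time \<open>t\<close> is at most \<open>\<gamma>\<^sup>t\<close>.
\<close>

lemma sums_policy_value:
  shows "(\<lambda>t. \<gamma> ^ t * measure_pmf.expectation (state_law p \<pi> i t) (\<lambda>s. policy_reward p r \<pi> $ s)) sums
    policy_value p r \<gamma> \<pi> $ i"
proof -
  interpret prob_space "trajectory_measure p \<pi> i"
    by (rule prob_space_trajectory_measure)
  let ?X = "\<lambda>t \<omega>. \<gamma> ^ t * r (fst (\<omega> t)) (fst (\<omega> (Suc t))) (snd (\<omega> t))"
  have bound: "norm (?X t \<omega>) \<le> \<gamma> ^ t" for t \<omega>
    using \<gamma> r[of "fst (\<omega> t)" "fst (\<omega> (Suc t))" "snd (\<omega> t)"] by (simp add: abs_mult mult_left_le)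
  have geometric: "summable (\<lambda>t. \<gamma> ^ t)"
    using \<gamma> by simp
  have meas: "?X t \<in> borel_measurable (trajectory_measure p \<pi> i)" for t
    by (intro borel_measurable_times borel_measurable_const borel_measurable_trajectory_transition)
  have int: "integrable (trajectory_measure p \<pi> i) (?X t)" for t
    by (rule integrable_const_bound[OF _ meas]) (use bound in auto)
  have "(\<integral>\<omega>. norm (?X t \<omega>) \<partial>trajectory_measure p \<pi> i) \<le> \<gamma> ^ t" for t
    using int bound by (intro integral_le_const) auto
  then have "summable (\<lambda>t. \<integral>\<omega>. norm (?X t \<omega>) \<partial>trajectory_measure p \<pi> i)"
    by (intro summable_comparison_test'[OF geometric]) (auto simp: integral_nonneg_AE)
  moreover have "AE \<omega> in trajectory_measure p \<pi> i. summable (\<lambda>t. norm (?X t \<omega>))"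
    using bound by (intro AE_I2 summable_comparison_test'[OF geometric]) auto
  ultimately have "(\<lambda>t. integral\<^sup>L (trajectory_measure p \<pi> i) (?X t)) sums
      (\<integral>\<omega>. (\<Sum>t. ?X t \<omega>) \<partial>trajectory_measure p \<pi> i)"
    by (intro sums_integral int)
  then show ?thesis
    using r by (simp add: policy_value_def expectation_trajectory_reward)
qed

text \<open>
  Every term of the series after the first is \<open>\<gamma>\<close> times a mean, over the first transition, of the
  preceding term of the series started from the state reached.
\<close>

lemma policy_value_bellman:
  "policy_value p r \<gamma> \<pi> = policy_reward p r \<pi> + \<gamma> *\<^sub>R (policy_matrix p \<pi> *v policy_value p r \<gamma> \<pi>)"
proof (rule vec_eq_iff[THEN iffD2], rule allI)
  fix i
  define E where "E t i = measure_pmf.expectation (state_law p \<pi> i t) (\<lambda>s. policy_reward p r \<pi> $ s)" for t i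
  have sums: "(\<lambda>t. \<gamma> ^ t * E t i) sums policy_value p r \<gamma> \<pi> $ i" for i
    unfolding E_def by (rule sums_policy_value)
  have pmf_step: "pmf (step_law p \<pi> i) j = policy_matrix p \<pi> $ i $ j" for j
    by (simp add: step_law_def pmf_bind integral_measure_pmf[of UNIV] policy_matrix_def)
  have "E (Suc t) i = (\<Sum>j\<in>UNIV. policy_matrix p \<pi> $ i $ j * E t j)" for t
    unfolding E_def state_law_Suc_first by (subst pmf_expectation_bind[of UNIV]) (simp_all add: pmf_step)
  moreover have "(\<lambda>t. \<Sum>j\<in>UNIV. \<gamma> * (policy_matrix p \<pi> $ i $ j * (\<gamma> ^ t * E t j))) sums
      (\<Sum>j\<in>UNIV. \<gamma> * (policy_matrix p \<pi> $ i $ j * policy_value p r \<gamma> \<pi> $ j))"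
    by (intro sums_sum sums_mult sums)
  ultimately have "(\<lambda>t. \<gamma> ^ Suc t * E (Suc t) i) sums
      (\<gamma> * (policy_matrix p \<pi> *v policy_value p r \<gamma> \<pi>) $ i)"
    by (simp add: matrix_vector_mult_def sum_distrib_left ac_simps)
  from sums_Suc[OF this] have "(\<lambda>t. \<gamma> ^ t * E t i) sums
      (\<gamma> * (policy_matrix p \<pi> *v policy_value p r \<gamma> \<pi>) $ i + E 0 i)"
    by simp
  with sums[of i] have "policy_value p r \<gamma> \<pi> $ i = \<gamma> * (policy_matrix p \<pi> *v policy_value p r \<gamma> \<pi>) $ i + E 0 i"
    by (rule sums_unique2)
  then show "policy_value p r \<gamma> \<pi> $ i =
      (policy_reward p r \<pi> + \<gamma> *\<^sub>R (policy_matrix p \<pi> *v policy_value p r \<gamma> \<pi>)) $ i"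
    by (simp add: E_def)
qed

section \<open>Policy improvement and the optimal value\<close>

text \<open>
  Averaged over the actions of \<open>\<pi>\<close>, the gap of \<open>w\<close> at \<open>i\<close> is the affine expression
  \<open>w - \<gamma> P\<^sup>\<pi> w - r\<^sup>\<pi>\<close>, which vanishes at \<open>v\<^sup>\<pi>\<close> by the Bellman equation. Hence it is linear in
  \<open>w - v\<^sup>\<pi>\<close>.
\<close>

lemma mean_bellman_gap:
  "(\<Sum>a\<in>UNIV. pmf (\<pi> i) a * bellman_gap p r \<gamma> w i a) =
    (w - policy_value p r \<gamma> \<pi>) $ i - \<gamma> * (policy_matrix p \<pi> *v (w - policy_value p r \<gamma> \<pi>)) $ i"
proof -
  let ?v = "policy_value p r \<gamma> \<pi>"
  have Pw: "(policy_matrix p \<pi> *v w) $ i = (\<Sum>a\<in>UNIV. pmf (\<pi> i) a * (\<Sum>j\<in>UNIV. pmf (p i a) j * w $ j))"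
    unfolding matrix_vector_mult_def policy_matrix_def
    by (simp add: sum_distrib_right sum_distrib_left mult.assoc) (rule sum.swap)
  have "(\<Sum>a\<in>UNIV. pmf (\<pi> i) a * bellman_gap p r \<gamma> w i a) =
      (\<Sum>a\<in>UNIV. pmf (\<pi> i) a * w $ i - \<gamma> * (pmf (\<pi> i) a * (\<Sum>j\<in>UNIV. pmf (p i a) j * w $ j)) -
        pmf (\<pi> i) a * (\<Sum>j\<in>UNIV. pmf (p i a) j * r i j a))"
    by (simp add: bellman_gap_def algebra_simps)
  also have "\<dots> = w $ i - \<gamma> * (policy_matrix p \<pi> *v w) $ i - policy_reward p r \<pi> $ i"
    by (simp add: sum_subtractf Pw policy_reward_def sum_distrib_left[symmetric]
        sum_distrib_right[symmetric] sum_pmf_eq_1)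
  also have "policy_reward p r \<pi> $ i = ?v $ i - \<gamma> * (policy_matrix p \<pi> *v ?v) $ i"
    using arg_cong[OF policy_value_bellman[where \<pi>=\<pi>], of "\<lambda>x. x $ i"] by simp
  finally show ?thesis
    by (simp add: matrix_vector_mult_diff_distrib algebra_simps)
qed

text \<open>
  The sign of the mean gaps of \<open>w\<close> decides how \<open>w\<close> compares with \<open>v\<^sup>\<pi>\<close>, in both directions.
\<close>

lemma policy_value_le:
  assumes gap: "\<And>i. 0 \<le> (\<Sum>a\<in>UNIV. pmf (\<pi> i) a * bellman_gap p r \<gamma> w i a)"
  shows "policy_value p r \<gamma> \<pi> $ i \<le> w $ i"
proof -
  let ?d = "policy_value p r \<gamma> \<pi> - w"
  have "?d $ j \<le> \<gamma> * (policy_matrix p \<pi> *v ?d) $ j" for j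
    using gap[of j] unfolding mean_bellman_gap
    by (simp add: matrix_vector_mult_diff_distrib algebra_simps)
  then have "?d $ i \<le> 0"
    using \<gamma> by (intro discounted_subharmonic_le_0[OF row_stochastic_policy_matrix]) auto
  then show ?thesis
    by simp
qed

lemma le_policy_value:
  assumes gap: "\<And>i. (\<Sum>a\<in>UNIV. pmf (\<pi> i) a * bellman_gap p r \<gamma> w i a) \<le> 0"
  shows "w $ i \<le> policy_value p r \<gamma> \<pi> $ i"
proof -
  let ?d = "w - policy_value p r \<gamma> \<pi>"
  have "?d $ j \<le> \<gamma> * (policy_matrix p \<pi> *v ?d) $ j" for j
    using gap[of j] unfolding mean_bellman_gap by simp
  then have "?d $ i \<le> 0"
    using \<gamma> by (intro discounted_subharmonic_le_0[OF row_stochastic_policy_matrix]) auto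
  then show ?thesis
    by simp
qed

text \<open>
  Policy improvement: take a deterministic policy \<open>f\<close> with the largest total value
  \<open>\<Sum>\<^sub>i v\<^sup>f\<^sub>i\<close>, one of finitely many. If some action \<open>a\<close> had a negative gap at \<open>i\<close>, then switching to
  \<open>a\<close> at \<open>i\<close> would lower no component of the value and would raise component \<open>i\<close>.
\<close>

lemma optimal_deterministic_policy_exists:
  obtains f where "\<And>i a. 0 \<le> bellman_gap p r \<gamma> (policy_value p r \<gamma> (\<lambda>i. return_pmf (f i))) i a"
proof -
  define v where "v f = policy_value p r \<gamma> (\<lambda>i. return_pmf (f i))" for f :: "'s \<Rightarrow> 'a"
  have mean: "(\<Sum>a\<in>UNIV. pmf (return_pmf (f i)) a * g a) = g (f i)" for f :: "'s \<Rightarrow> 'a" and g i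
  proof -
    have "(\<Sum>a\<in>UNIV. pmf (return_pmf (f i)) a * g a) = (\<Sum>a\<in>UNIV. if a = f i then g a else 0)"
      by (intro sum.cong) (auto simp: indicator_def)
    then show ?thesis
      by simp
  qed
  have gap_v: "bellman_gap p r \<gamma> (v f) i (f i) = 0" for f i
    using mean_bellman_gap[where \<pi>="\<lambda>i. return_pmf (f i)" and i=i and w="v f"] by (simp add: mean v_def)
  obtain f where f: "\<And>f'. (\<Sum>i\<in>UNIV. v f' $ i) \<le> (\<Sum>i\<in>UNIV. v f $ i)"
  proof -
    let ?V = "range (\<lambda>f. \<Sum>i\<in>UNIV. v f $ i)"
    have "finite ?V" "?V \<noteq> {}"
      by auto
    then have "Max ?V \<in> ?V" and "\<And>x. x \<in> ?V \<Longrightarrow> x \<le> Max ?V"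
      by (rule Max_in, simp)
    then show thesis
      using that by fastforce
  qed
  have "0 \<le> bellman_gap p r \<gamma> (v f) i a" for i a
  proof (rule ccontr)
    assume neg: "\<not> 0 \<le> bellman_gap p r \<gamma> (v f) i a"
    define f' where "f' = f(i := a)"
    have f'_i: "f' i = a"
      by (simp add: f'_def)
    have gap': "bellman_gap p r \<gamma> (v f) j (f' j) \<le> 0" for j
      using neg gap_v[of f j] by (simp add: f'_def)
    have le: "v f $ j \<le> v f' $ j" for j
      unfolding v_def[of f'] by (rule le_policy_value) (simp add: mean gap')
    \<comment> \<open>At \<open>i\<close> the improvement exceeds the discounted improvement after one step by the size of
      the negative gap.\<close>
    let ?P = "policy_matrix p (\<lambda>i. return_pmf (f' i))"
    have "0 \<le> (?P *v (v f' - v f)) $ i"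
      using row_stochastic_policy_matrix[of p "\<lambda>i. return_pmf (f' i)"] le
      by (auto simp: matrix_vector_mult_def row_stochastic_def intro!: sum_nonneg mult_nonneg_nonneg)
    moreover have "bellman_gap p r \<gamma> (v f) i a =
        \<gamma> * (?P *v (v f' - v f)) $ i - (v f' - v f) $ i"
      using mean_bellman_gap[where \<pi>="\<lambda>i. return_pmf (f' i)" and i=i and w="v f"]
      by (simp add: mean v_def[symmetric] f'_i matrix_vector_mult_diff_distrib algebra_simps)
    ultimately have "v f $ i < v f' $ i"
      using neg \<gamma> by (smt (verit) mult_nonneg_nonneg vector_minus_component)
    then have "(\<Sum>j\<in>UNIV. v f $ j) < (\<Sum>j\<in>UNIV. v f' $ j)"
      using le by (intro sum_strict_mono_ex1) auto
    with f[of f'] show False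
      by simp
  qed
  then show ?thesis
    by (intro that[of f]) (simp add: v_def)
qed

text \<open>
  Nonnegative gaps for all actions make the value of one policy an upper bound for the values of all
  policies, randomized ones included. So the componentwise supremum is attained by that policy and
  inherits its gaps.
\<close>

lemma
  shows policy_value_le_optimal_value: "policy_value p r \<gamma> \<pi> $ i \<le> optimal_value p r \<gamma> $ i"
    and bellman_gap_optimal_value_nonneg: "0 \<le> bellman_gap p r \<gamma> (optimal_value p r \<gamma>) i a"
proof -
  obtain f where gap: "\<And>i a. 0 \<le> bellman_gap p r \<gamma> (policy_value p r \<gamma> (\<lambda>i. return_pmf (f i))) i a"
    using optimal_deterministic_policy_exists by blast
  let ?\<sigma> = "\<lambda>i. return_pmf (f i)"
  have le: "policy_value p r \<gamma> \<pi> $ i \<le> policy_value p r \<gamma> ?\<sigma> $ i" for \<pi> i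
    by (rule policy_value_le) (intro sum_nonneg mult_nonneg_nonneg pmf_nonneg gap)
  have "optimal_value p r \<gamma> $ i = policy_value p r \<gamma> ?\<sigma> $ i" for i
    unfolding optimal_value_def by (simp, rule cSup_eq_maximum) (auto intro: le)
  then have "optimal_value p r \<gamma> = policy_value p r \<gamma> ?\<sigma>"
    by (simp add: vec_eq_iff)
  with le gap show "policy_value p r \<gamma> \<pi> $ i \<le> optimal_value p r \<gamma> $ i"
    and "0 \<le> bellman_gap p r \<gamma> (optimal_value p r \<gamma>) i a"
    by simp_all
qed

end

section \<open>The duality gap bound\<close>

text \<open>
  On the left of \<open>I - \<gamma> P\<close>, a stationary distribution acts as an eigenvector with eigenvalue
  \<open>1 - \<gamma>\<close>. This is how a mean of \<open>d\<close> is recovered from a mean of \<open>d - \<gamma> P d\<close>.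
\<close>

lemma stationary_discounted_identity:
  fixes d :: "real^'s::finite"
  assumes "stationary_distribution p \<pi> \<nu>"
  shows "(\<Sum>i\<in>UNIV. \<nu> $ i * (d $ i - \<gamma> * (policy_matrix p \<pi> *v d) $ i)) = (1 - \<gamma>) * (\<nu> \<bullet> d)"
proof -
  have "\<nu> \<bullet> (policy_matrix p \<pi> *v d) = \<nu> \<bullet> d"
    using assms by (metis dot_lmul_matrix stationary_distribution_def transpose_matrix_vector)
  moreover have "(\<Sum>i\<in>UNIV. \<nu> $ i * (d $ i - \<gamma> * (policy_matrix p \<pi> *v d) $ i)) =
      \<nu> \<bullet> d - \<gamma> * (\<nu> \<bullet> (policy_matrix p \<pi> *v d))"
    by (simp add: inner_vec_def algebra_simps sum_subtractf sum_distrib_left)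
  ultimately show ?thesis
    by (simp add: algebra_simps)
qed

theorem proposition4:
  fixes p :: "'s::finite \<Rightarrow> 'a::finite \<Rightarrow> 's pmf"
    and r :: "'s \<Rightarrow> 's \<Rightarrow> 'a \<Rightarrow> real"
    and \<gamma> c\<^sub>1 c\<^sub>2 \<theta> :: real
    and q :: "real^'s"
    and \<mu> :: "real^'s^'a"
    and \<pi> :: "'s \<Rightarrow> 'a pmf"
  assumes "0 < \<gamma>" and "\<gamma> < 1"
    and "\<And>i j a. r i j a \<in> {0..1}"
    and "probability_vector q" and "\<And>i. 0 < q $ i"
    and "0 < c\<^sub>1" and "0 < c\<^sub>2"
    and "ergodic p q c\<^sub>1 c\<^sub>2"
    and "\<theta> = 1 - \<gamma> + \<gamma> * (c\<^sub>1 / c\<^sub>2)"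
    and "\<mu> \<in> dual_simplex \<theta> q"
    and "\<And>i a. pmf (\<pi> i) a = \<mu> $ a $ i / (\<Sum>a'\<in>UNIV. \<mu> $ a' $ i)"
  shows "q \<bullet> optimal_value p r \<gamma> - q \<bullet> policy_value p r \<gamma> \<pi> \<le>
    c\<^sub>2\<^sup>2 / ((1 - \<gamma>) * c\<^sub>1\<^sup>2) *
      (\<Sum>a\<in>UNIV. \<Sum>i\<in>UNIV. \<mu> $ a $ i *
        (optimal_value p r \<gamma> $ i - \<gamma> * (\<Sum>j\<in>UNIV. pmf (p i a) j * optimal_value p r \<gamma> $ j)
               - (\<Sum>j\<in>UNIV. pmf (p i a) j * r i j a)))"
proof -
  note \<gamma> = assms(1,2) and r = assms(3) and q_pos = assms(5) and c = assms(6,7)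
    and ergodic = assms(8) and \<theta> = assms(9) and \<pi> = assms(11)
  let ?v = "optimal_value p r \<gamma>" and ?P = "policy_matrix p \<pi>"
  define d where "d = ?v - policy_value p r \<gamma> \<pi>"
  define g where "g i = d $ i - \<gamma> * (?P *v d) $ i" for i
  define \<xi> where "\<xi> i = (\<Sum>a\<in>UNIV. \<mu> $ a $ i)" for i
  have d_nonneg: "0 \<le> d $ i" for i
    using policy_value_le_optimal_value[where r=r, OF \<gamma> r] by (simp add: d_def)
  have mean_gap: "(\<Sum>a\<in>UNIV. pmf (\<pi> i) a * bellman_gap p r \<gamma> ?v i a) = g i" for i
    by (simp only: mean_bellman_gap[where r=r, OF \<gamma> r] d_def g_def)
  have g_nonneg: "0 \<le> g i" for i
    unfolding mean_gap[symmetric]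
    by (intro sum_nonneg mult_nonneg_nonneg bellman_gap_optimal_value_nonneg[where r=r, OF \<gamma> r] pmf_nonneg)

  obtain \<nu> where \<nu>: "stationary_distribution p \<pi> \<nu>"
    by (rule stationary_distribution_exists)
  then have \<nu>_ge: "c\<^sub>1 * q $ i \<le> \<nu> $ i" and \<nu>_le: "\<nu> $ i \<le> c\<^sub>2 * q $ i" for i
    using ergodic by (auto simp: ergodic_def less_eq_vec_def)
  \<comment> \<open>\<open>\<theta>\<close> is a convex combination of \<open>1\<close> and \<open>c\<^sub>1 / c\<^sub>2 \<le> 1\<close>, so it is at least \<open>c\<^sub>1 / c\<^sub>2\<close>.\<close>
  have "c\<^sub>1 \<le> c\<^sub>2"
    using order_trans[OF \<nu>_ge \<nu>_le, of undefined] q_pos[of undefined] by simp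
  then have "0 \<le> (1 - \<gamma>) * (1 - c\<^sub>1 / c\<^sub>2)"
    using \<gamma> c by simp
  also have "\<dots> = \<theta> - c\<^sub>1 / c\<^sub>2"
    using c by (simp add: \<theta> field_simps)
  finally have c_\<theta>: "c\<^sub>1 / c\<^sub>2 \<le> \<theta>"
    by simp
  have "\<theta> * q $ i \<le> \<xi> i" for i
    using assms(10) by (simp add: dual_simplex_def less_eq_vec_def \<xi>_def)
  then have \<xi>_ge: "c\<^sub>1 / c\<^sub>2 * q $ i \<le> \<xi> i" for i
    using c_\<theta> q_pos[of i] by (meson mult_right_mono less_imp_le order_trans)
  have \<xi>_pos: "0 < \<xi> i" for i
    using \<xi>_ge[of i] c q_pos[of i] by (smt (verit) divide_pos_pos mult_pos_pos)
  have \<mu>: "\<mu> $ a $ i = \<xi> i * pmf (\<pi> i) a" for a i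
    using \<xi>_pos[of i] by (simp add: \<pi> \<xi>_def)
  have \<nu>_le_\<xi>: "\<nu> $ i \<le> c\<^sub>2\<^sup>2 / c\<^sub>1 * \<xi> i" for i
  proof -
    have "c\<^sub>2 * q $ i = c\<^sub>2\<^sup>2 / c\<^sub>1 * (c\<^sub>1 / c\<^sub>2 * q $ i)"
      using c by (simp add: power2_eq_square)
    also have "\<dots> \<le> c\<^sub>2\<^sup>2 / c\<^sub>1 * \<xi> i"
      using c by (intro mult_left_mono \<xi>_ge) simp
    finally show ?thesis
      using \<nu>_le[of i] by simp
  qed

  have "c\<^sub>1 * (q \<bullet> d) \<le> \<nu> \<bullet> d"
    unfolding inner_vec_def sum_distrib_left
    by (rule sum_mono) (use mult_right_mono[OF \<nu>_ge d_nonneg] in \<open>simp add: mult.assoc\<close>)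
  also have "\<nu> \<bullet> d = (\<Sum>i\<in>UNIV. \<nu> $ i * g i) / (1 - \<gamma>)"
    using stationary_discounted_identity[OF \<nu>, of d \<gamma>] \<gamma> by (simp add: g_def)
  also have "\<dots> \<le> (\<Sum>i\<in>UNIV. c\<^sub>2\<^sup>2 / c\<^sub>1 * \<xi> i * g i) / (1 - \<gamma>)"
    using \<gamma> by (intro divide_right_mono sum_mono mult_right_mono \<nu>_le_\<xi> g_nonneg) simp
  also have "(\<Sum>i\<in>UNIV. c\<^sub>2\<^sup>2 / c\<^sub>1 * \<xi> i * g i) = c\<^sub>2\<^sup>2 / c\<^sub>1 * (\<Sum>i\<in>UNIV. \<xi> i * g i)"
    by (simp only: sum_distrib_left mult.assoc)
  also have "\<dots> / (1 - \<gamma>) = c\<^sub>1 * (c\<^sub>2\<^sup>2 / ((1 - \<gamma>) * c\<^sub>1\<^sup>2) * (\<Sum>i\<in>UNIV. \<xi> i * g i))"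
    using c \<gamma> by (simp add: power2_eq_square ac_simps)
  finally have "q \<bullet> d \<le> c\<^sub>2\<^sup>2 / ((1 - \<gamma>) * c\<^sub>1\<^sup>2) * (\<Sum>i\<in>UNIV. \<xi> i * g i)"
    using c by (simp only: mult_le_cancel_left_pos)
  also have "(\<Sum>i\<in>UNIV. \<xi> i * g i) = (\<Sum>a\<in>UNIV. \<Sum>i\<in>UNIV. \<mu> $ a $ i * bellman_gap p r \<gamma> ?v i a)"
    unfolding mean_gap[symmetric] \<mu> by (subst sum.swap) (simp add: sum_distrib_left mult.assoc)
  finally show ?thesis
    by (simp add: d_def inner_diff_right bellman_gap_def)
qed

end
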